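(* Let $d\ge 1$ be an integer, $T>0$, $M\ge 0$ and $s>\tfrac d2$. Suppose $f\in C\bigl([0,T];H^s(\mathbb{T}^d)\bigr)$ with $\sup_{t\in[0,T]}\|f(t)\|_{H^s}\le M$, and write $f(t,x)=\sum_{k\in\mathbb{Z}^d}\widehat f(t,k)\,e^{i k\cdot x}$. Then for each $t\in[0,T]$ and each $k\in\mathbb{Z}^d\setminus\{0\}$, $$|\widehat f(t,k)|\le M\,(1+\|k\|^2)^{-s/2},$$ and there exists a constant $C=C(d,s)$ such that for every integer $K\ge 1$ and every $t\in[0,T]$, $$\sum_{\|k\|>K}|\widehat f(t,k)|^2\le C\,M^2\,K^{\,d-2s},\qquad \sum_{\|k\|\le K}|\widehat f(t,k)|^2=\|f(t)\|_{L^2}^2-O\bigl(K^{\,d-2s}\bigr).$$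
   Context: $\mathbb{T}^d=(\mathbb{R}/2\pi\mathbb{Z})^d$; $\|k\|$ is the Euclidean norm of $k\in\mathbb{Z}^d$. The Sobolev norm is $\|f(t)\|_{H^s}^2=\sum_{k\in\mathbb{Z}^d}(1+\|k\|^2)^s|\widehat f(t,k)|^2$. The $L^2(\mathbb{T}^d)$ norm is taken with respect to normalized measure $(2\pi)^{-d}dx$, so that Parseval reads $\|f(t)\|_{L^2}^2=\sum_{k}|\widehat f(t,k)|^2$. The term $O(K^{d-2s})$ denotes a nonnegative quantity bounded by a constant depending only on $d,s,M$ times $K^{d-2s}$, uniformly in $t\in[0,T]$ and $K\ge1$. *)

theory Defs
  imports "HOL-Analysis.Analysis"
begin

text \<open>
  A function on the torus \<open>(\<real> / 2\<pi>\<int>)\<^sup>d\<close> is represented by a function on \<open>real ^ 'n\<close> with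
  \<open>d = CARD('n)\<close> that is \<open>2\<pi>\<close>-periodic in every coordinate. Elements of \<open>L\<^sup>2\<close> and \<open>H\<^sup>s\<close> are
  represented by functions rather than by almost-everywhere classes; the norms and coefficients
  below depend on the class only.
\<close>

definition int_vec :: "int ^ 'n \<Rightarrow> real ^ 'n" where
  "int_vec k = (\<chi> i. real_of_int (k $ i))"

definition torus_fun :: "(real ^ 'n \<Rightarrow> complex) \<Rightarrow> bool" where
  "torus_fun f \<longleftrightarrow> (\<forall>x k. f (x + (2 * pi) *\<^sub>R int_vec k) = f x)"

definition torus_cell :: "(real ^ 'n) set" where
  "torus_cell = cbox 0 (\<chi> i. 2 * pi)"

text \<open>The integral with respect to the normalized measure \<open>(2\<pi>)\<^sup>-\<^sup>d dx\<close>.\<close>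

definition torus_integral ::
  "(real ^ 'n \<Rightarrow> 'b :: {banach, second_countable_topology}) \<Rightarrow> 'b" where
  "torus_integral g = (1 / (2 * pi) ^ CARD('n)) *\<^sub>R integral\<^sup>L (lebesgue_on torus_cell) g"

definition torus_L2 :: "(real ^ 'n \<Rightarrow> complex) set" where
  "torus_L2 = {f. torus_fun f \<and> f \<in> borel_measurable lebesgue \<and>
     integrable (lebesgue_on torus_cell) (\<lambda>x. (cmod (f x))\<^sup>2)}"

definition torus_L2_norm :: "(real ^ 'n \<Rightarrow> complex) \<Rightarrow> real" where
  "torus_L2_norm f = sqrt (torus_integral (\<lambda>x. (cmod (f x))\<^sup>2))"

definition fourier_coeff :: "(real ^ 'n \<Rightarrow> complex) \<Rightarrow> int ^ 'n \<Rightarrow> complex" where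
  "fourier_coeff f k = torus_integral (\<lambda>x. f x * exp (- (\<i> * complex_of_real (int_vec k \<bullet> x))))"

text \<open>
  The space \<open>H\<^sup>s\<close> as a subspace of \<open>L\<^sup>2\<close>, which is the usual Sobolev space for \<open>s \<ge> 0\<close>
  (for \<open>s < 0\<close> the latter also contains distributions).
\<close>

definition sobolev_space :: "real \<Rightarrow> (real ^ 'n \<Rightarrow> complex) set" where
  "sobolev_space s = {f \<in> torus_L2.
     (\<lambda>k. (1 + (norm (int_vec k))\<^sup>2) powr s * (cmod (fourier_coeff f k))\<^sup>2) summable_on UNIV}"

definition sobolev_norm :: "real \<Rightarrow> (real ^ 'n \<Rightarrow> complex) \<Rightarrow> real" where
  "sobolev_norm s f =
     sqrt (\<Sum>\<^sub>\<infinity>k. (1 + (norm (int_vec k))\<^sup>2) powr s * (cmod (fourier_coeff f k))\<^sup>2)"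

definition continuous_sobolev :: "real \<Rightarrow> real \<Rightarrow> (real \<Rightarrow> real ^ 'n \<Rightarrow> complex) set" where
  "continuous_sobolev T s = {f. (\<forall>t\<in>{0..T}. f t \<in> sobolev_space s) \<and>
     (\<forall>t\<in>{0..T}. ((\<lambda>u. sobolev_norm s (\<lambda>x. f u x - f t x)) \<longlongrightarrow> 0) (at t within {0..T}))}"

end

theory Submission
  imports Defs
begin

text \<open>
  The coefficient and tail bounds follow by comparison with the series of the Sobolev norm: on
  \<open>\<parallel>k\<parallel> > K\<close> its weight is at least \<open>K\<^sup>2\<^sup>s\<close>, so the tail is even at most \<open>M\<^sup>2 K\<^sup>-\<^sup>2\<^sup>s\<close>. The last identity is
  Parseval's theorem on the torus, with \<open>r\<close> the tail. By the orthonormality of the characters, it amounts to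
  the density of trigonometric polynomials in \<open>L\<^sup>2\<close>. A bounded measurable function is an almost everywhere
  limit of continuous functions; these are transported to the compact torus in \<open>\<complex>\<^sup>d\<close>, where
  Stone--Weierstrass applies, and dominated convergence gives \<open>L\<^sup>2\<close> approximation. Truncation
  reduces the general case to bounded functions.
\<close>

section \<open>Characters of the torus\<close>

definition character :: "int ^ 'n \<Rightarrow> real ^ 'n \<Rightarrow> complex" where
  "character k x = exp (\<i> * complex_of_real (int_vec k \<bullet> x))"

lemma int_vec_nth [simp]: "int_vec k $ i = real_of_int (k $ i)"
  by (simp add: int_vec_def)

lemma int_vec_0 [simp]: "int_vec 0 = 0"
  by (simp add: int_vec_def vec_eq_iff)

lemma int_vec_add: "int_vec (k + l) = int_vec k + int_vec l"
  by (simp add: vec_eq_iff)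

lemma int_vec_minus: "int_vec (- k) = - int_vec k"
  by (simp add: vec_eq_iff)

lemma character_0 [simp]: "character 0 x = 1"
  by (simp add: character_def)

lemma character_add: "character (k + l) x = character k x * character l x"
  by (simp add: character_def int_vec_add algebra_simps exp_add)

lemma cnj_character: "cnj (character k x) = character (- k) x"
  by (simp add: character_def int_vec_minus exp_cnj)

lemma norm_character [simp]: "norm (character k x) = 1"
  by (simp add: character_def)

lemma continuous_on_character [continuous_intros]: "continuous_on S (character k)"
  unfolding character_def by (intro continuous_intros)

lemma measurable_character [measurable]: "character k \<in> borel_measurable borel"
  by (intro borel_measurable_continuous_onI continuous_on_character)

lemma fourier_coeff_eq: "fourier_coeff f k = torus_integral (\<lambda>x. f x * cnj (character k x))"
  by (simp add: fourier_coeff_def character_def exp_cnj)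

section \<open>Orthonormality of the characters\<close>

text \<open>Lebesgue measure on a Euclidean space is the image of the product of one-dimensional
  Lebesgue measures under \<open>y \<mapsto> (\<Sum>c\<in>Basis. y c *\<^sub>R c)\<close>, and
  Fubini factors the integral there.\<close>

lemma integral_lborel_prod:
  fixes f :: "'a::euclidean_space \<Rightarrow> real \<Rightarrow> complex"
  assumes "\<And>b. b \<in> Basis \<Longrightarrow> integrable lborel (f b)"
  shows "(\<integral>x. (\<Prod>b\<in>Basis. f b (x \<bullet> b)) \<partial>(lborel :: 'a measure))
       = (\<Prod>b\<in>Basis. integral\<^sup>L lborel (f b))"
proof -
  interpret product_sigma_finite "\<lambda>_. lborel :: real measure" ..
  have [measurable]: "f b \<in> borel_measurable borel" if "b \<in> Basis" for b
    using borel_measurable_integrable[OF assms[OF that]] by simp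
  have "(\<integral>x. (\<Prod>b\<in>Basis. f b (x \<bullet> b)) \<partial>(lborel :: 'a measure))
      = (\<integral>y. (\<Prod>b\<in>Basis. f b ((\<Sum>c\<in>Basis. y c *\<^sub>R c) \<bullet> b)) \<partial>(\<Pi>\<^sub>M b\<in>(Basis::'a set). lborel))"
    by (subst lborel_eq[where 'a='a], subst integral_distr) simp_all
  also have "\<dots> = (\<integral>y. (\<Prod>b\<in>Basis. f b (y b)) \<partial>(\<Pi>\<^sub>M b\<in>(Basis::'a set). lborel))"
    by (intro Bochner_Integration.integral_cong prod.cong) (auto simp: inner_sum_left_Basis)
  also have "\<dots> = (\<Prod>b\<in>Basis. integral\<^sup>L lborel (f b))"
    by (intro product_integral_prod assms) auto
  finally show ?thesis .
qed

lemma integral_exp_period: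
  fixes m :: int
  shows "(\<integral>x. indicator {0..2 * pi} x *\<^sub>R exp (\<i> * complex_of_real (of_int m * x)) \<partial>lborel)
       = (if m = 0 then 2 * pi else 0)"
proof (cases "m = 0")
  case False
  have "(\<integral>x. indicator {0..2 * pi} x *\<^sub>R exp (\<i> * complex_of_real (of_int m * x)) \<partial>lborel)
      = exp (\<i> * complex_of_real (of_int m * (2 * pi))) / (\<i> * of_int m)
        - exp (\<i> * complex_of_real (of_int m * 0)) / (\<i> * of_int m)"
  proof (rule integral_FTC_Icc)
    fix x :: real
    \<comment> \<open>The antiderivative is differentiated in a complex variable and then restricted
      to the real line. Its values at the two ends of the period agree.\<close>
    have "((\<lambda>z. exp (\<i> * (of_int m * z)) / (\<i> * of_int m)) has_field_derivative
        exp (\<i> * (of_int m * complex_of_real x))) (at (complex_of_real x))"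
      using False by (auto intro!: derivative_eq_intros simp: mult_ac)
    from has_vector_derivative_real_field[OF this]
    show "((\<lambda>x. exp (\<i> * complex_of_real (of_int m * x)) / (\<i> * of_int m)) has_vector_derivative
        exp (\<i> * complex_of_real (of_int m * x))) (at x within {0..2 * pi})"
      by simp
  qed (auto intro!: continuous_intros)
  moreover have "exp (\<i> * complex_of_real (of_int m * (2 * pi))) = 1"
    using exp_integer_2pi[of "of_int m"] by (simp add: algebra_simps)
  ultimately show ?thesis
    using False by simp
qed (simp add: scaleR_conv_of_real)

lemma sets_torus_cell [measurable, simp]: "torus_cell \<in> sets borel" "torus_cell \<in> sets lebesgue"
  by (auto simp: torus_cell_def)

lemma finite_measure_torus_cell:
  "finite_measure (lebesgue_on (torus_cell :: (real ^ 'n) set))"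
  by (auto intro!: finite_measure_lebesgue_on simp: torus_cell_def)

lemma torus_cell_iff: "x \<in> torus_cell \<longleftrightarrow> (\<forall>i. x $ i \<in> {0..2 * pi})"
  by (auto simp: torus_cell_def mem_box_cart)

text \<open>The integral factors over the coordinates, and a single nonzero \<open>k $ i\<close>
  makes its factor vanish. Since \<open>character k x * cnj (character l x)\<close> is
  \<open>character (k - l) x\<close>, this is orthonormality.\<close>

lemma torus_integral_character:
  "torus_integral (character k :: real ^ 'n \<Rightarrow> complex) = (if k = 0 then 1 else 0)"
proof -
  \<comment> \<open>The indicator of the cell is itself a product, so each factor carries its own
    cut-off and is integrated over the whole line.\<close>
  define f :: "real ^ 'n \<Rightarrow> real \<Rightarrow> complex" where
    "f = (\<lambda>b x. indicator {0..2 * pi} x *\<^sub>R exp (\<i> * complex_of_real ((int_vec k \<bullet> b) * x)))"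
  have prod_f: "indicator torus_cell x *\<^sub>R character k x = (\<Prod>b\<in>Basis. f b (x \<bullet> b))" for x
  proof -
    have "(\<Prod>b\<in>Basis. f b (x \<bullet> b))
        = (\<Prod>b\<in>Basis. indicator {0..2 * pi} (x \<bullet> b))
          *\<^sub>R (\<Prod>b\<in>Basis. exp (\<i> * complex_of_real ((int_vec k \<bullet> b) * (x \<bullet> b))))"
      by (simp add: f_def scaleR_conv_of_real prod.distrib)
    also have "(\<Prod>b\<in>Basis. exp (\<i> * complex_of_real ((int_vec k \<bullet> b) * (x \<bullet> b)))) = character k x"
      by (simp add: character_def euclidean_inner[of "int_vec k" x] sum_distrib_left flip: exp_sum)
    also have "(\<Prod>b\<in>Basis. indicator {0..2 * pi} (x \<bullet> b)) = (indicator torus_cell x :: real)"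
      by (cases "x \<in> torus_cell")
        (auto simp: torus_cell_iff Basis_vec_def inner_axis intro!: prod.neutral prod_zero split: split_indicator)
    finally show ?thesis ..
  qed
  have int_f: "integral\<^sup>L lborel (f (axis i 1)) = (if k $ i = 0 then 2 * pi else 0)" for i
    using integral_exp_period[of "k $ i"] by (simp add: f_def inner_axis)
  have "integral\<^sup>L (lebesgue_on torus_cell) (character k)
      = (\<integral>x. indicator torus_cell x *\<^sub>R character k x \<partial>lebesgue)"
    by (rule integral_restrict_space) simp
  \<comment> \<open>The integrand is Borel measurable, so passing from the completed measure to
    \<open>lborel\<close> leaves the integral unchanged.\<close>
  also have "\<dots> = (\<integral>x. indicator torus_cell x *\<^sub>R character k x \<partial>lborel)"
    by (rule integral_completion) simp
  also have "\<dots> = (\<Prod>b\<in>Basis. integral\<^sup>L lborel (f b))"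
    unfolding prod_f
    by (rule integral_lborel_prod) (auto simp: f_def intro!: borel_integrable_compact continuous_intros)
  also have "\<dots> = (\<Prod>i\<in>UNIV. if k $ i = 0 then 2 * pi else 0)"
    unfolding Basis_vec_def by (subst prod.UNION_disjoint) (auto simp: int_f axis_eq_axis)
  also have "\<dots> = (if k = 0 then (2 * pi) ^ CARD('n) else 0)"
    by (auto simp: vec_eq_iff)
  finally show ?thesis
    by (simp add: torus_integral_def scaleR_conv_of_real)
qed

section \<open>Calculus of the normalized integral\<close>

lemma torus_integral_add:
  assumes "integrable (lebesgue_on torus_cell) f" "integrable (lebesgue_on torus_cell) g"
  shows "torus_integral (\<lambda>x. f x + g x) = torus_integral f + torus_integral g"
  using assms by (simp add: torus_integral_def scaleR_add_right)

lemma torus_integral_diff: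
  assumes "integrable (lebesgue_on torus_cell) f" "integrable (lebesgue_on torus_cell) g"
  shows "torus_integral (\<lambda>x. f x - g x) = torus_integral f - torus_integral g"
  using assms by (simp add: torus_integral_def scaleR_diff_right)

lemma torus_integral_sum:
  assumes "\<And>i. i \<in> I \<Longrightarrow> integrable (lebesgue_on torus_cell) (f i)"
  shows "torus_integral (\<lambda>x. \<Sum>i\<in>I. f i x) = (\<Sum>i\<in>I. torus_integral (f i))"
  using assms by (simp add: torus_integral_def scaleR_sum_right)

lemma torus_integral_mult_left:
  fixes c :: complex
  shows "torus_integral (\<lambda>x. c * f x) = c * torus_integral f"
  by (simp add: torus_integral_def)

lemma torus_integral_of_real:
  "torus_integral (\<lambda>x. complex_of_real (f x)) = complex_of_real (torus_integral f)"
  by (simp add: torus_integral_def scaleR_conv_of_real)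

lemma torus_integral_cnj: "torus_integral (\<lambda>x. cnj (f x)) = cnj (torus_integral f)"
  by (simp add: torus_integral_def)

lemma torus_integral_nonneg:
  fixes f :: "real ^ 'n \<Rightarrow> real"
  assumes "\<And>x. 0 \<le> f x"
  shows "0 \<le> torus_integral f"
  using assms by (simp add: torus_integral_def)

lemma measurable_lebesgue_on_borel:
  "f \<in> borel_measurable borel \<Longrightarrow> f \<in> borel_measurable (lebesgue_on S)"
  by (intro measurable_restrict_space1 measurable_completion) simp

lemma integrable_torus_cell_bounded:
  fixes f :: "real ^ 'n \<Rightarrow> 'b :: {banach, second_countable_topology}"
  assumes "f \<in> borel_measurable (lebesgue_on torus_cell)" "\<And>x. norm (f x) \<le> B"
  shows "integrable (lebesgue_on torus_cell) f"
  by (rule finite_measure.integrable_const_bound[OF finite_measure_torus_cell, where B = B])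
    (use assms in auto)

lemma integrable_character: "integrable (lebesgue_on torus_cell) (character k)"
  by (rule integrable_torus_cell_bounded[where B = 1])
    (auto intro: measurable_lebesgue_on_borel measurable_character)

lemma integrable_mult_cnj_character:
  assumes "integrable (lebesgue_on torus_cell) f"
  shows "integrable (lebesgue_on torus_cell) (\<lambda>x. f x * cnj (character k x))"
proof -
  have [measurable]: "character (- k) \<in> borel_measurable (lebesgue_on torus_cell)"
    by (intro measurable_lebesgue_on_borel measurable_character)
  have [measurable]: "f \<in> borel_measurable (lebesgue_on torus_cell)"
    using assms by measurable
  show ?thesis
    unfolding cnj_character
    by (rule Bochner_Integration.integrable_bound[OF assms]) (auto simp: norm_mult)
qed

text \<open>Integrability comes from the bound of \<open>cmod z\<close> by
  \<open>1 + (cmod z)\<^sup>2\<close>, a consequence of \<open>(cmod z - 1)\<^sup>2 \<ge> 0\<close>,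
  on a cell of finite measure. It is what lets the integrals defining Fourier coefficients be
  handled by linearity.\<close>

lemma torus_L2_D:
  assumes "f \<in> torus_L2"
  shows torus_L2_measurable: "f \<in> borel_measurable (lebesgue_on torus_cell)"
    and torus_L2_square_integrable: "integrable (lebesgue_on torus_cell) (\<lambda>x. (cmod (f x))\<^sup>2)"
    and torus_L2_integrable: "integrable (lebesgue_on torus_cell) f"
proof -
  show meas: "f \<in> borel_measurable (lebesgue_on torus_cell)"
    using assms by (auto simp: torus_L2_def intro: measurable_restrict_space1)
  show sq: "integrable (lebesgue_on torus_cell) (\<lambda>x. (cmod (f x))\<^sup>2)"
    using assms by (simp add: torus_L2_def)
  have "integrable (lebesgue_on torus_cell) (\<lambda>x. 1 + (cmod (f x))\<^sup>2)"
    by (intro Bochner_Integration.integrable_add sq integrable_torus_cell_bounded[where B = 1]) auto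
  then show "integrable (lebesgue_on torus_cell) f"
  proof (rule Bochner_Integration.integrable_bound)
    have "cmod z \<le> 1 + (cmod z)\<^sup>2" for z
      using zero_le_power2[of "cmod z - 1"] unfolding power2_diff
      by (simp add: power2_eq_square) (smt (verit) norm_ge_zero)
    then show "AE x in lebesgue_on torus_cell. norm (f x) \<le> norm (1 + (cmod (f x))\<^sup>2)"
      by simp
  qed (use meas in simp)
qed

section \<open>Mean square distance to a trigonometric polynomial\<close>

text \<open>Expanding the square and completing it frequency by frequency. The identity serves
  Parseval twice: the choice of \<open>c\<close> as the Fourier coefficients gives Bessel's
  inequality, and an arbitrary \<open>c\<close> bounds the Bessel defect by the distance.\<close>

lemma torus_integral_dist_trig_poly:
  fixes f :: "real ^ 'n \<Rightarrow> complex" and c :: "int ^ 'n \<Rightarrow> complex"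
  assumes f: "f \<in> torus_L2" and F: "finite F"
  shows "torus_integral (\<lambda>x. (cmod (f x - (\<Sum>k\<in>F. c k * character k x)))\<^sup>2)
       = torus_integral (\<lambda>x. (cmod (f x))\<^sup>2) - (\<Sum>k\<in>F. (cmod (fourier_coeff f k))\<^sup>2)
         + (\<Sum>k\<in>F. (cmod (c k - fourier_coeff f k))\<^sup>2)"
proof -
  define p where "p x = (\<Sum>k\<in>F. c k * character k x)" for x
  define g where "g x = (\<Sum>k\<in>F. cnj (c k) * (f x * cnj (character k x)))" for x
  define h where "h x = (\<Sum>k\<in>F. \<Sum>l\<in>F. (c k * cnj (c l)) * character (k - l) x)" for x
  note ints = torus_L2_square_integrable[OF f] integrable_mult_cnj_character[OF torus_L2_integrable[OF f]]
    integrable_character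
  have gf: "f x * cnj (p x) = g x" for x
    by (simp add: g_def p_def sum_distrib_left algebra_simps)
  have hp: "p x * cnj (p x) = h x" for x
    by (simp add: h_def p_def sum_product cnj_character algebra_simps diff_conv_add_uminus character_add
        del: add_uminus_conv_diff)
  \<comment> \<open>The cross term, twice a real part, is written as \<open>g x + cnj (g x)\<close>,
    so that the whole expansion is integrated by linearity over the complex numbers.\<close>
  have eq: "complex_of_real ((cmod (f x - p x))\<^sup>2)
      = (complex_of_real ((cmod (f x))\<^sup>2) - (g x + cnj (g x))) + h x" for x
    unfolding complex_norm_square gf[symmetric] hp[symmetric] by (simp add: algebra_simps)
  have int_g: "integrable (lebesgue_on torus_cell) g"
    unfolding g_def by (intro Bochner_Integration.integrable_sum integrable_mult_right ints)
  have int_h: "integrable (lebesgue_on torus_cell) h"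
    unfolding h_def by (intro Bochner_Integration.integrable_sum integrable_mult_right ints)
  have T_g: "torus_integral g = (\<Sum>k\<in>F. cnj (c k) * fourier_coeff f k)"
    unfolding g_def fourier_coeff_eq
    by (subst torus_integral_sum) (auto simp: torus_integral_mult_left intro!: integrable_mult_right ints)
  have "torus_integral h = (\<Sum>k\<in>F. \<Sum>l\<in>F. c k * cnj (c l) * (if k - l = 0 then 1 else 0))"
    unfolding h_def torus_integral_character[symmetric] torus_integral_mult_left[symmetric]
    by (subst torus_integral_sum
        | intro sum.cong refl Bochner_Integration.integrable_sum integrable_mult_right ints)+
  \<comment> \<open>Only the diagonal \<open>k = l\<close> survives.\<close>
  also have "\<dots> = (\<Sum>k\<in>F. c k * cnj (c k))"
    using F by (intro sum.cong) (auto simp: if_distrib cong: if_cong)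
  finally have T_h: "torus_integral h = (\<Sum>k\<in>F. c k * cnj (c k))" .
  have "complex_of_real (torus_integral (\<lambda>x. (cmod (f x - p x))\<^sup>2))
      = complex_of_real (torus_integral (\<lambda>x. (cmod (f x))\<^sup>2))
        - (torus_integral g + cnj (torus_integral g)) + torus_integral h"
    unfolding torus_integral_of_real[symmetric] eq torus_integral_cnj[symmetric]
    by (subst torus_integral_add torus_integral_diff
        | intro ints int_g int_h Bochner_Integration.integrable_diff Bochner_Integration.integrable_add
          integrable_of_real integrable_cnj refl)+
  also have "\<dots> = complex_of_real (torus_integral (\<lambda>x. (cmod (f x))\<^sup>2)
      - (\<Sum>k\<in>F. (cmod (fourier_coeff f k))\<^sup>2) + (\<Sum>k\<in>F. (cmod (c k - fourier_coeff f k))\<^sup>2))"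
    unfolding T_g T_h of_real_add of_real_diff of_real_sum complex_norm_square
    by (simp add: algebra_simps sum.distrib sum_subtractf)
  finally show ?thesis
    unfolding p_def of_real_eq_iff .
qed

section \<open>The algebra of trigonometric polynomials\<close>

text \<open>Generation by two rules turns closure under products, which Stone-Weierstrass requires,
  into rule induction. The explicit finite sum is recovered in \<open>trig_polysE\<close>.\<close>

inductive_set trig_polys :: "(real ^ 'n \<Rightarrow> complex) set" where
  monomial: "(\<lambda>x. c * character k x) \<in> trig_polys"
| add: "p \<in> trig_polys \<Longrightarrow> q \<in> trig_polys \<Longrightarrow> (\<lambda>x. p x + q x) \<in> trig_polys"

lemma trig_polys_const: "(\<lambda>x. c) \<in> trig_polys"
  using trig_polys.monomial[of c 0] by simp

lemma trig_polys_mult_monomial: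
  "p \<in> trig_polys \<Longrightarrow> (\<lambda>x. c * character k x * p x) \<in> trig_polys"
proof (induction rule: trig_polys.induct)
  case (monomial d l)
  then show ?case
    using trig_polys.monomial[of "c * d" "k + l"] by (simp add: character_add mult_ac)
next
  case (add p q)
  then show ?case
    by (simp add: distrib_left trig_polys.add)
qed

lemma trig_polys_mult:
  assumes "p \<in> trig_polys" "q \<in> trig_polys"
  shows "(\<lambda>x. p x * q x) \<in> trig_polys"
  using assms(1)
proof (induction rule: trig_polys.induct)
  case (add p p')
  then show ?case
    by (simp add: distrib_right trig_polys.add)
qed (use assms(2) in \<open>rule trig_polys_mult_monomial\<close>)

lemma trig_polysE:
  assumes "p \<in> trig_polys"
  obtains F c where "finite F" "p = (\<lambda>x. \<Sum>k\<in>F. c k * character k x)"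
proof -
  have "\<exists>F c. finite F \<and> p = (\<lambda>x. \<Sum>k\<in>F. c k * character k x)"
    using assms
  proof (induction rule: trig_polys.induct)
    case (monomial c k)
    show ?case
      by (rule exI[of _ "{k}"], rule exI[of _ "\<lambda>_. c"]) simp
  next
    case (add p q)
    then obtain F c G d where F: "finite F" "p = (\<lambda>x. \<Sum>k\<in>F. c k * character k x)"
      and G: "finite G" "q = (\<lambda>x. \<Sum>k\<in>G. d k * character k x)"
      by blast
    \<comment> \<open>Extending both coefficient families by 0 gives the two sums the common index
      set \<open>F \<union> G\<close>.\<close>
    define c' where "c' k = (if k \<in> F then c k else 0)" for k
    define d' where "d' k = (if k \<in> G then d k else 0)" for k
    have "p x = (\<Sum>k\<in>F \<union> G. c' k * character k x)" for x
      unfolding F(2) c'_def by (rule sum.mono_neutral_cong_left) (use F G in auto)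
    moreover have "q x = (\<Sum>k\<in>F \<union> G. d' k * character k x)" for x
      unfolding G(2) d'_def by (rule sum.mono_neutral_cong_left) (use F G in auto)
    ultimately have "(\<lambda>x. p x + q x) = (\<lambda>x. \<Sum>k\<in>F \<union> G. (c' k + d' k) * character k x)"
      by (simp add: sum.distrib distrib_right)
    with F(1) G(1) show ?case
      by (intro exI[of _ "F \<union> G"] exI[of _ "\<lambda>k. c' k + d' k"]) simp
  qed
  with that show thesis
    by blast
qed

lemma continuous_on_trig_poly: "p \<in> trig_polys \<Longrightarrow> continuous_on S p"
  by (induction rule: trig_polys.induct) (auto intro!: continuous_intros)

section \<open>Uniform approximation on the embedded torus\<close>

lemma character_axis: "character (axis i m) x = cis (of_int m * x $ i)"
proof -
  have "int_vec (axis i m) = axis i (of_int m)"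
    by (simp add: vec_eq_iff axis_def)
  then show ?thesis
    by (simp add: character_def cis_conv_exp inner_axis' mult_ac)
qed

text \<open>The image of the cell is a product of unit circles. Opposite faces of the cell are glued
  there, so trigonometric polynomials descend to functions that separate points; on the cell itself
  they cannot tell opposite faces apart.\<close>

definition torus_embed :: "real ^ 'n \<Rightarrow> complex ^ 'n" where
  "torus_embed x = (\<chi> i. cis (x $ i))"

lemma continuous_on_torus_embed: "continuous_on S torus_embed"
  unfolding torus_embed_def by (intro continuous_intros)

lemma compact_torus_embed: "compact (torus_embed ` torus_cell)"
  by (intro compact_continuous_image continuous_on_torus_embed) (simp add: torus_cell_def)

lemma trig_poly_uniform_approx_real:
  fixes h :: "complex ^ 'n \<Rightarrow> real"
  assumes h: "continuous_on (torus_embed ` torus_cell) h" and e: "0 < e"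
  obtains p where "p \<in> trig_polys"
    "\<And>x. x \<in> torus_cell \<Longrightarrow> cmod (complex_of_real (h (torus_embed x)) - p x) < e"
proof -
  \<comment> \<open>The subalgebra for the real Stone-Weierstrass theorem: real functions on the
    image whose pull-back to the angles is a trigonometric polynomial.\<close>
  define P where "P g \<longleftrightarrow> continuous_on (torus_embed ` torus_cell) g \<and>
    (\<lambda>x. complex_of_real (g (torus_embed x))) \<in> trig_polys" for g :: "complex ^ 'n \<Rightarrow> real"
  have P_Re: "P (\<lambda>z. Re (z $ i))" for i
  proof -
    \<comment> \<open>Euler's formula for the cosine; the sine is treated likewise below. These
      coordinate functions separate the points of the image.\<close>
    have eq: "complex_of_real (Re (torus_embed x $ i))
        = (1/2) * character (axis i 1) x + (1/2) * character (axis i (-1)) x" for x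
      by (simp add: character_axis torus_embed_def complex_eq_iff)
    have "(\<lambda>x. complex_of_real (Re (torus_embed x $ i))) \<in> trig_polys"
      unfolding eq by (intro trig_polys.intros)
    then show ?thesis
      unfolding P_def by (auto intro!: continuous_intros)
  qed
  have P_Im: "P (\<lambda>z. Im (z $ i))" for i
  proof -
    have eq: "complex_of_real (Im (torus_embed x $ i))
        = (-\<i>/2) * character (axis i 1) x + (\<i>/2) * character (axis i (-1)) x" for x
      by (simp add: character_axis torus_embed_def complex_eq_iff)
    have "(\<lambda>x. complex_of_real (Im (torus_embed x $ i))) \<in> trig_polys"
      unfolding eq by (intro trig_polys.intros)
    then show ?thesis
      unfolding P_def by (auto intro!: continuous_intros)
  qed
  have "\<exists>g. P g \<and> (\<forall>z\<in>torus_embed ` torus_cell. \<bar>h z - g z\<bar> < e)"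
  proof (rule Stone_Weierstrass_HOL[OF compact_torus_embed _ _ _ _ _ h e, of P])
    show "P (\<lambda>x. c)" for c
      by (simp add: P_def trig_polys_const)
    show "P f \<and> P g \<Longrightarrow> P (\<lambda>x. f x + g x)" for f g
      by (auto simp: P_def intro!: continuous_intros trig_polys.add)
    show "P f \<and> P g \<Longrightarrow> P (\<lambda>x. f x * g x)" for f g
      by (auto simp: P_def intro!: continuous_intros trig_polys_mult)
    show "\<exists>f. P f \<and> f z \<noteq> f w"
      if "z \<in> torus_embed ` torus_cell \<and> w \<in> torus_embed ` torus_cell \<and> z \<noteq> w" for z w
    proof -
      from that obtain i where "Re (z $ i) \<noteq> Re (w $ i) \<or> Im (z $ i) \<noteq> Im (w $ i)"
        by (auto simp: vec_eq_iff complex_eq_iff)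
      with P_Re[of i] P_Im[of i] show ?thesis
        by blast
    qed
  qed (simp add: P_def)
  then obtain g where g: "P g" "\<And>x. x \<in> torus_cell \<Longrightarrow> \<bar>h (torus_embed x) - g (torus_embed x)\<bar> < e"
    by blast
  show thesis
  proof (rule that)
    show "(\<lambda>x. complex_of_real (g (torus_embed x))) \<in> trig_polys"
      using g(1) by (simp add: P_def)
    show "cmod (complex_of_real (h (torus_embed x)) - complex_of_real (g (torus_embed x))) < e"
      if "x \<in> torus_cell" for x
      using g(2)[OF that] by (metis norm_of_real of_real_diff)
  qed
qed

text \<open>The real case handles the real and the imaginary part up to \<open>e / 2\<close> each.
  The polynomials have complex coefficients, so \<open>p x + \<i> * q x\<close> is again one of
  them.\<close>

lemma trig_poly_uniform_approx:
  fixes h :: "complex ^ 'n \<Rightarrow> complex"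
  assumes h: "continuous_on (torus_embed ` torus_cell) h" and e: "0 < e"
  obtains p where "p \<in> trig_polys" "\<And>x. x \<in> torus_cell \<Longrightarrow> cmod (h (torus_embed x) - p x) < e"
proof -
  have e2: "0 < e / 2"
    using e by simp
  obtain p where p: "p \<in> trig_polys"
    "\<And>x. x \<in> torus_cell \<Longrightarrow> cmod (complex_of_real (Re (h (torus_embed x))) - p x) < e / 2"
    using trig_poly_uniform_approx_real[OF continuous_on_Re[OF h] e2] by blast
  obtain q where q: "q \<in> trig_polys"
    "\<And>x. x \<in> torus_cell \<Longrightarrow> cmod (complex_of_real (Im (h (torus_embed x))) - q x) < e / 2"
    using trig_poly_uniform_approx_real[OF continuous_on_Im[OF h] e2] by blast
  show thesis
  proof (rule that)
    show "(\<lambda>x. p x + \<i> * q x) \<in> trig_polys"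
      using trig_polys.add[OF p(1) trig_polys_mult[OF trig_polys_const q(1)]] .
    show "cmod (h (torus_embed x) - (p x + \<i> * q x)) < e" if x: "x \<in> torus_cell" for x
    proof -
      let ?z = "h (torus_embed x)"
      have "?z - (p x + \<i> * q x) = (complex_of_real (Re ?z) - p x) + \<i> * (complex_of_real (Im ?z) - q x)"
        by (subst complex_eq[of ?z]) (simp add: algebra_simps)
      then have "cmod (?z - (p x + \<i> * q x))
          \<le> cmod (complex_of_real (Re ?z) - p x) + cmod (complex_of_real (Im ?z) - q x)"
        by (metis norm_triangle_ineq norm_mult norm_ii mult_1)
      with p(2)[OF x] q(2)[OF x] show ?thesis
        by linarith
    qed
  qed
qed

section \<open>Approximation away from the boundary of the cell\<close>

text \<open>\<open>Arg2pi\<close> takes values in the half-open interval from 0 to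
  \<open>2 * pi\<close>; the strict upper bound leaves out the face that is glued to the one at
  0.\<close>

lemma torus_embed_inverse:
  assumes "\<And>i. 0 \<le> x $ i" "\<And>i. x $ i < 2 * pi"
  shows "(\<chi> i. Arg2pi (torus_embed x $ i)) = x"
proof -
  have "Arg2pi (cis (x $ i)) = x $ i" for i
    using assms by (intro Arg2pi_unique[of 1]) (auto simp: cis_conv_exp)
  then show ?thesis
    by (simp add: torus_embed_def vec_eq_iff)
qed

text \<open>On a compact box inside the open cell the embedding is a homeomorphism onto its image, so Tietze
  extends from there to the torus; nothing but the bound survives near the boundary of the cell.\<close>

lemma trig_poly_approx_interior:
  fixes g :: "real ^ 'n \<Rightarrow> complex"
  assumes g: "continuous_on UNIV g" and B: "\<And>x. cmod (g x) \<le> B" and d: "0 < d" and e: "0 < e"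
  obtains p where "p \<in> trig_polys"
    "\<And>x. (\<And>i. x $ i \<in> {d..2 * pi - d}) \<Longrightarrow> cmod (g x - p x) < e"
    "\<And>x. x \<in> torus_cell \<Longrightarrow> cmod (p x) \<le> B + e"
proof -
  define K where "K = cbox (\<chi> i. d) ((\<chi> i. 2 * pi - d) :: real ^ 'n)"
  have K_iff: "x \<in> K \<longleftrightarrow> (\<forall>i. x $ i \<in> {d..2 * pi - d})" for x
    by (auto simp: K_def mem_box_cart)
  define angles :: "complex ^ 'n \<Rightarrow> real ^ 'n" where "angles z = (\<chi> i. Arg2pi (z $ i))" for z
  have angles: "angles (torus_embed x) = x" if "x \<in> K" for x
    unfolding angles_def
  proof (rule torus_embed_inverse)
    show "0 \<le> x $ i" "x $ i < 2 * pi" for i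
      using that[unfolded K_iff, rule_format, of i] d by auto
  qed
  have "compact K"
    by (simp add: K_def)
  \<comment> \<open>Continuity comes from the compactness of \<open>K\<close>, on which
    \<open>angles\<close> is a left inverse of a continuous map, and not from properties of
    \<open>Arg2pi\<close>.\<close>
  then have "continuous_on (torus_embed ` K) angles"
    by (intro continuous_on_inv continuous_on_torus_embed) (auto simp: angles)
  then have cont: "continuous_on (torus_embed ` K) (g \<circ> angles)"
    by (intro continuous_on_compose continuous_on_subset[OF g]) auto
  have "closed (torus_embed ` K)"
    by (intro compact_imp_closed compact_continuous_image continuous_on_torus_embed \<open>compact K\<close>)
  then have "closedin (top_of_set UNIV) (torus_embed ` K)"
    by simp
  moreover have "0 \<le> B"
    using B norm_ge_zero order_trans by blast
  ultimately obtain h where h: "continuous_on UNIV h" "\<And>z. z \<in> torus_embed ` K \<Longrightarrow> h z = (g \<circ> angles) z"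
    "\<And>z. z \<in> UNIV \<Longrightarrow> cmod (h z) \<le> B"
    using Tietze[OF cont] B by (metis comp_apply)
  obtain p where p: "p \<in> trig_polys" "\<And>x. x \<in> torus_cell \<Longrightarrow> cmod (h (torus_embed x) - p x) < e"
    using trig_poly_uniform_approx[OF continuous_on_subset[OF h(1)] e] by blast
  show thesis
  proof (rule that[OF p(1)])
    fix x :: "real ^ 'n"
    assume "\<And>i. x $ i \<in> {d..2 * pi - d}"
    then have x: "x \<in> K"
      by (simp add: K_iff)
    have "x \<in> torus_cell"
      unfolding torus_cell_iff
    proof
      show "x $ i \<in> {0..2 * pi}" for i
        using x[unfolded K_iff, rule_format, of i] d by auto
    qed
    from p(2)[OF this] show "cmod (g x - p x) < e"
      using h(2)[of "torus_embed x"] x by (simp add: angles)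
  next
    fix x :: "real ^ 'n"
    assume "x \<in> torus_cell"
    from p(2)[OF this] h(3)[of "torus_embed x"] show "cmod (p x) \<le> B + e"
      using norm_triangle_sub[of "p x" "h (torus_embed x)"] by (simp add: norm_minus_commute)
  qed
qed

section \<open>Density of trigonometric polynomials in the mean square sense\<close>

lemma AE_torus_cell_interior:
  "AE x in lebesgue_on (torus_cell :: (real ^ 'n) set). x \<in> box 0 (\<chi> i. 2 * pi)"
proof -
  let ?N = "torus_cell - box 0 (\<chi> i. 2 * pi) :: (real ^ 'n) set"
  have "negligible ?N"
    unfolding torus_cell_def using negligible_frontier_interval by blast
  then have "?N \<in> null_sets lebesgue"
    by (simp add: negligible_iff_null_sets)
  then show ?thesis
    by (subst AE_restrict_space_iff) (auto intro!: AE_I'[of ?N])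
qed

lemma trig_polys_dense_bounded:
  fixes f :: "real ^ 'n \<Rightarrow> complex"
  assumes f: "f \<in> borel_measurable (lebesgue_on torus_cell)" and B: "\<And>x. cmod (f x) \<le> B"
    and e: "0 < e"
  obtains p where "p \<in> trig_polys" "torus_integral (\<lambda>x. (cmod (f x - p x))\<^sup>2) < e"
proof -
  have B0: "0 \<le> B"
    using B norm_ge_zero order_trans by blast
  have "f measurable_on torus_cell"
    using f by (simp add: measurable_on_iff_borel_measurable)
  then obtain N g where N: "negligible N" and g: "\<And>n. continuous_on UNIV (g n)"
    "\<And>x. x \<notin> N \<Longrightarrow> (\<lambda>n::nat. g n x) \<longlonglongrightarrow> (if x \<in> torus_cell then f x else 0)"
    unfolding measurable_on_def by blast
  \<comment> \<open>Nearest-point projection onto the ball of radius \<open>B\<close> is continuous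
    and fixes the values of \<open>f\<close>. Clipping thus keeps the limit and supplies the uniform
    bound for domination.\<close>
  define G where "G n x = closest_point (cball 0 B) (g n x)" for n x
  have cont_clip: "continuous_on UNIV (closest_point (cball (0::complex) B))"
    using B0 by (intro continuous_on_closest_point) auto
  have cont_G: "continuous_on UNIV (G n)" for n
    unfolding G_def using continuous_on_compose2[OF cont_clip g(1)] by simp
  have G_le: "cmod (G n x) \<le> B" for n x
    using closest_point_in_set[of "cball (0::complex) B" "g n x"] B0 by (simp add: G_def)
  have G_lim: "(\<lambda>n. G n x) \<longlonglongrightarrow> f x" if "x \<notin> N" "x \<in> torus_cell" for x
  proof -
    have "isCont (closest_point (cball (0::complex) B)) (f x)"
      using cont_clip by (simp add: continuous_on_eq_continuous_at)
    moreover have "(\<lambda>n. g n x) \<longlonglongrightarrow> f x"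
      using g(2)[OF that(1)] that(2) by simp
    ultimately have "(\<lambda>n. G n x) \<longlonglongrightarrow> closest_point (cball 0 B) (f x)"
      unfolding G_def by (rule isCont_tendsto_compose)
    then show ?thesis
      using B[of x] by (simp add: closest_point_self)
  qed
  \<comment> \<open>One index governs both the margin at the boundary and the error.
    \<open>Suc n\<close> keeps \<open>1 / Suc n\<close> positive at \<open>n = 0\<close>.\<close>
  have "\<exists>p. p \<in> trig_polys \<and>
      (\<forall>x. (\<forall>i. x $ i \<in> {1 / Suc n..2 * pi - 1 / Suc n}) \<longrightarrow> cmod (G n x - p x) < 1 / Suc n) \<and>
      (\<forall>x\<in>torus_cell. cmod (p x) \<le> B + 1 / Suc n)" for n
    using trig_poly_approx_interior[OF cont_G[of n] G_le[of n], of "1 / Suc n" "1 / Suc n"]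
    by (smt (verit) divide_pos_pos of_nat_0_less_iff zero_less_Suc)
  then obtain p where p: "\<And>n. p n \<in> trig_polys"
    "\<And>n x. (\<And>i. x $ i \<in> {1 / Suc n..2 * pi - 1 / Suc n}) \<Longrightarrow> cmod (G n x - p n x) < 1 / Suc n"
    "\<And>n x. x \<in> torus_cell \<Longrightarrow> cmod (p n x) \<le> B + 1 / Suc n"
    by metis
  have lim: "(\<lambda>n. (cmod (f x - p n x))\<^sup>2) \<longlonglongrightarrow> 0"
    if x: "x \<notin> N" "x \<in> torus_cell" "x \<in> box 0 (\<chi> i. 2 * pi)" for x
  proof -
    \<comment> \<open>An interior point has positive distance from each face; as there are finitely
      many coordinates, the shrinking margins eventually leave it in the good region.\<close>
    have "0 < min (x $ i) (2 * pi - x $ i)" for i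
      using x(3) by (auto simp: mem_box_cart)
    then have "\<forall>\<^sub>F n in sequentially. 1 / Suc n < min (x $ i) (2 * pi - x $ i)" for i
      by (intro order_tendstoD(2)[OF LIMSEQ_Suc[OF lim_1_over_n]])
    then have "\<forall>\<^sub>F n in sequentially. \<forall>i. 1 / Suc n < min (x $ i) (2 * pi - x $ i)"
      by (intro eventually_all_finite) auto
    then have "\<forall>\<^sub>F n in sequentially. cmod (G n x - p n x) \<le> 1 / Suc n"
    proof eventually_elim
      case (elim n)
      have "x $ i \<in> {1 / Suc n..2 * pi - 1 / Suc n}" for i
        using elim[rule_format, of i] by simp
      from p(2)[OF this] show ?case
        by simp
    qed
    then have "(\<lambda>n. G n x - p n x) \<longlonglongrightarrow> 0"
      by (rule Lim_null_comparison[OF _ LIMSEQ_Suc[OF lim_1_over_n]])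
    from tendsto_diff[OF G_lim[OF x(1,2)] this] have "(\<lambda>n. p n x) \<longlonglongrightarrow> f x"
      by simp
    then have "(\<lambda>n. (cmod (f x - p n x))\<^sup>2) \<longlonglongrightarrow> (cmod (f x - f x))\<^sup>2"
      by (intro tendsto_intros)
    then show ?thesis
      by simp
  qed
  have p_meas: "p n \<in> borel_measurable (lebesgue_on torus_cell)" for n
    by (intro measurable_lebesgue_on_borel borel_measurable_continuous_onI continuous_on_trig_poly p(1))
  have "(\<lambda>n. integral\<^sup>L (lebesgue_on torus_cell) (\<lambda>x. (cmod (f x - p n x))\<^sup>2))
      \<longlonglongrightarrow> integral\<^sup>L (lebesgue_on (torus_cell :: (real ^ 'n) set)) (\<lambda>x. 0)"
  \<comment> \<open>\<open>B\<close> bounds \<open>f\<close>, and \<open>B + 1\<close> bounds every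
    \<open>p n\<close> on the cell because \<open>1 / Suc n \<le> 1\<close>.\<close>
  proof (rule integral_dominated_convergence[where w = "\<lambda>_. (B + (B + 1))\<^sup>2"])
    show "integrable (lebesgue_on (torus_cell :: (real ^ 'n) set)) (\<lambda>_. (B + (B + 1))\<^sup>2)"
      by (rule integrable_torus_cell_bounded) auto
    show "(\<lambda>x. (cmod (f x - p n x))\<^sup>2) \<in> borel_measurable (lebesgue_on torus_cell)" for n
      using f p_meas by measurable
    have "AE x in lebesgue_on torus_cell. x \<notin> N"
      using N unfolding negligible_iff_null_sets
      by (subst AE_restrict_space_iff) (auto intro!: AE_I'[of N])
    then show "AE x in lebesgue_on torus_cell. (\<lambda>n. (cmod (f x - p n x))\<^sup>2) \<longlonglongrightarrow> 0"
      using AE_torus_cell_interior AE_space by eventually_elim (rule lim, simp_all)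
    have "cmod (f x - p n x) \<le> B + (B + 1)" if "x \<in> torus_cell" for x n
    proof -
      have "1 / real (Suc n) \<le> 1"
        by simp
      then show ?thesis
        using norm_triangle_ineq4[of "f x" "p n x"] B[of x] p(3)[OF that, of n] by linarith
    qed
    then show "AE x in lebesgue_on torus_cell. norm ((cmod (f x - p n x))\<^sup>2) \<le> (B + (B + 1))\<^sup>2" for n
      by (auto intro!: AE_I2 power_mono)
  qed auto
  then have "(\<lambda>n. torus_integral (\<lambda>x. (cmod (f x - p n x))\<^sup>2)) \<longlonglongrightarrow> 0"
    unfolding torus_integral_def by (auto intro!: tendsto_eq_intros)
  then have "\<forall>\<^sub>F n in sequentially. torus_integral (\<lambda>x. (cmod (f x - p n x))\<^sup>2) < e"
    using e by (rule order_tendstoD(2))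
  then obtain n where "torus_integral (\<lambda>x. (cmod (f x - p n x))\<^sup>2) < e"
    using eventually_happens'[OF sequentially_bot] by blast
  with p(1) that show thesis
    by blast
qed

lemma trig_polys_dense:
  fixes f :: "real ^ 'n \<Rightarrow> complex"
  assumes f: "f \<in> torus_L2" and e: "0 < e"
  obtains p where "p \<in> trig_polys" "torus_integral (\<lambda>x. (cmod (f x - p x))\<^sup>2) < e"
proof -
  note [measurable] = torus_L2_measurable[OF f]
  note f_sq = torus_L2_square_integrable[OF f]
  \<comment> \<open>Large values are replaced by 0, so \<open>f x - F n x\<close> is either 0 or
    \<open>f x\<close>. Hence \<open>(cmod (f x))\<^sup>2\<close> dominates, and at each point the
    difference is eventually 0.\<close>
  define F where "F n x = (if cmod (f x) \<le> real n then f x else 0)" for n x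
  have F_meas [measurable]: "F n \<in> borel_measurable (lebesgue_on torus_cell)" for n
    unfolding F_def by measurable
  have "(\<lambda>n. integral\<^sup>L (lebesgue_on torus_cell) (\<lambda>x. (cmod (f x - F n x))\<^sup>2))
      \<longlonglongrightarrow> integral\<^sup>L (lebesgue_on (torus_cell :: (real ^ 'n) set)) (\<lambda>x. 0)"
  proof (rule integral_dominated_convergence[OF _ _ f_sq])
    have "\<forall>\<^sub>F n in sequentially. (cmod (f x - F n x))\<^sup>2 = 0" for x
      using eventually_ge_at_top[of "nat \<lceil>cmod (f x)\<rceil>"]
      by eventually_elim (simp add: F_def nat_ceiling_le_eq)
    then show "AE x in lebesgue_on torus_cell. (\<lambda>n. (cmod (f x - F n x))\<^sup>2) \<longlonglongrightarrow> 0"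
      by (intro AE_I2 tendsto_eventually)
    show "AE x in lebesgue_on torus_cell. norm ((cmod (f x - F n x))\<^sup>2) \<le> (cmod (f x))\<^sup>2" for n
      by (auto simp: F_def)
  qed simp_all
  then have "(\<lambda>n. torus_integral (\<lambda>x. (cmod (f x - F n x))\<^sup>2)) \<longlonglongrightarrow> 0"
    unfolding torus_integral_def by (auto intro!: tendsto_eq_intros)
  \<comment> \<open>The square of a sum is at most twice the sum of the squares, so two errors below
    \<open>e / 4\<close> add up to less than \<open>e\<close>.\<close>
  moreover have "0 < e / 4"
    using e by simp
  ultimately have "\<forall>\<^sub>F n in sequentially. torus_integral (\<lambda>x. (cmod (f x - F n x))\<^sup>2) < e / 4"
    by (rule order_tendstoD(2))
  then obtain n where n: "torus_integral (\<lambda>x. (cmod (f x - F n x))\<^sup>2) < e / 4"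
    using eventually_happens'[OF sequentially_bot] by blast
  have F_le: "cmod (F n x) \<le> real n" for x
    by (simp add: F_def)
  obtain p where p: "p \<in> trig_polys" "torus_integral (\<lambda>x. (cmod (F n x - p x))\<^sup>2) < e / 4"
    using trig_polys_dense_bounded[OF F_meas F_le \<open>0 < e / 4\<close>] by blast
  have p_meas [measurable]: "p \<in> borel_measurable (lebesgue_on torus_cell)"
    by (intro measurable_lebesgue_on_borel borel_measurable_continuous_onI continuous_on_trig_poly p(1))
  have int1: "integrable (lebesgue_on torus_cell) (\<lambda>x. (cmod (f x - F n x))\<^sup>2)"
    by (rule Bochner_Integration.integrable_bound[OF f_sq]) (auto simp: F_def)
  \<comment> \<open>A bound on the compact cell makes the second error term integrable.\<close>
  obtain b where b: "\<And>x. x \<in> torus_cell \<Longrightarrow> cmod (p x) \<le> b"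
  proof -
    have "compact (p ` torus_cell)"
      by (intro compact_continuous_image continuous_on_trig_poly p(1)) (simp add: torus_cell_def)
    then have "\<exists>b. \<forall>x\<in>torus_cell. cmod (p x) \<le> b"
      by (auto dest!: compact_imp_bounded simp: bounded_iff)
    then show thesis
      using that by blast
  qed
  have int2: "integrable (lebesgue_on torus_cell) (\<lambda>x. (cmod (F n x - p x))\<^sup>2)"
  proof (rule finite_measure.integrable_const_bound[OF finite_measure_torus_cell])
    have "(cmod (F n x - p x))\<^sup>2 \<le> (n + b)\<^sup>2" if "x \<in> torus_cell" for x
      using norm_triangle_ineq4[of "F n x" "p x"] F_le[of x] b[OF that] by (intro power_mono) auto
    then show "AE x in lebesgue_on torus_cell. norm ((cmod (F n x - p x))\<^sup>2) \<le> (n + b)\<^sup>2"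
      by (auto intro!: AE_I2)
  qed measurable
  have sq_le: "(cmod (f x - p x))\<^sup>2 \<le> 2 * ((cmod (f x - F n x))\<^sup>2 + (cmod (F n x - p x))\<^sup>2)" for x
  proof -
    have "(cmod (f x - p x))\<^sup>2 \<le> (cmod (f x - F n x) + cmod (F n x - p x))\<^sup>2"
      using norm_triangle_ineq[of "f x - F n x" "F n x - p x"] by (intro power_mono) auto
    also have "\<dots> \<le> 2 * ((cmod (f x - F n x))\<^sup>2 + (cmod (F n x - p x))\<^sup>2)"
      using sum_squares_bound[of "cmod (f x - F n x)" "cmod (F n x - p x)"]
      by (simp add: power2_sum)
    finally show ?thesis .
  qed
  have int3: "integrable (lebesgue_on torus_cell)
      (\<lambda>x. 2 * ((cmod (f x - F n x))\<^sup>2 + (cmod (F n x - p x))\<^sup>2))"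
    by (intro integrable_mult_right Bochner_Integration.integrable_add int1 int2)
  have "torus_integral (\<lambda>x. (cmod (f x - p x))\<^sup>2)
      \<le> torus_integral (\<lambda>x. 2 * ((cmod (f x - F n x))\<^sup>2 + (cmod (F n x - p x))\<^sup>2))"
    unfolding torus_integral_def
    by (intro scaleR_left_mono integral_mono int3 Bochner_Integration.integrable_bound[OF int3])
      (use sq_le in auto)
  also have "\<dots> = 2 * (torus_integral (\<lambda>x. (cmod (f x - F n x))\<^sup>2)
      + torus_integral (\<lambda>x. (cmod (F n x - p x))\<^sup>2))"
    unfolding torus_integral_add[OF int1 int2, symmetric]
    by (simp add: torus_integral_def del: distrib_left_numeral)
  also have "\<dots> < e"
    using n p(2) by simp
  finally show thesis
    using that[OF p(1)] by blast
qed

section \<open>Parseval's identity\<close>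

text \<open>If \<open>p\<close> with frequencies in \<open>F\<close> is within \<open>e\<close> of
  \<open>f\<close> in mean square, every partial sum over a finite \<open>G \<supseteq> F\<close>
  lies between \<open>I - e\<close> and \<open>I\<close>. This is convergence along the net of
  finite sets, so no enumeration of the frequencies enters.\<close>

theorem Parseval:
  fixes f :: "real ^ 'n \<Rightarrow> complex"
  assumes f: "f \<in> torus_L2"
  shows "((\<lambda>k. (cmod (fourier_coeff f k))\<^sup>2) has_sum (torus_L2_norm f)\<^sup>2) UNIV"
proof -
  define I where "I = torus_integral (\<lambda>x. (cmod (f x))\<^sup>2)"
  have "torus_L2_norm f ^ 2 = I"
    by (simp add: torus_L2_norm_def I_def torus_integral_nonneg)
  moreover have "((\<lambda>k. (cmod (fourier_coeff f k))\<^sup>2) has_sum I) UNIV"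
    unfolding has_sum_def
  proof (rule tendstoI)
    fix e :: real
    assume "0 < e"
    then obtain p where p: "p \<in> trig_polys" "torus_integral (\<lambda>x. (cmod (f x - p x))\<^sup>2) < e"
      using trig_polys_dense[OF f] by blast
    then obtain F c where F: "finite F" and pF: "p = (\<lambda>x. \<Sum>k\<in>F. c k * character k x)"
      using trig_polysE by blast
    have "dist (\<Sum>k\<in>G. (cmod (fourier_coeff f k))\<^sup>2) I < e" if G: "finite G" "F \<subseteq> G" for G
    proof -
      \<comment> \<open>Bessel's inequality: with the Fourier coefficients as \<open>c\<close> the
        last sum of the distance formula vanishes.\<close>
      have "0 \<le> torus_integral (\<lambda>x. (cmod (f x - (\<Sum>k\<in>G. fourier_coeff f k * character k x)))\<^sup>2)"
        by (intro torus_integral_nonneg) simp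
      then have "(\<Sum>k\<in>G. (cmod (fourier_coeff f k))\<^sup>2) \<le> I"
        using torus_integral_dist_trig_poly[OF f G(1), of "fourier_coeff f"] by (simp add: I_def)
      moreover have "(\<Sum>k\<in>F. (cmod (fourier_coeff f k))\<^sup>2) \<le> (\<Sum>k\<in>G. (cmod (fourier_coeff f k))\<^sup>2)"
        using G by (intro sum_mono2) auto
      moreover have "0 \<le> (\<Sum>k\<in>F. (cmod (c k - fourier_coeff f k))\<^sup>2)"
        by (intro sum_nonneg) simp
      then have "I - (\<Sum>k\<in>F. (cmod (fourier_coeff f k))\<^sup>2) < e"
        using p(2) torus_integral_dist_trig_poly[OF f F, of c] by (simp add: I_def pF)
      ultimately show ?thesis
        by (simp add: dist_real_def)
    qed
    then show "\<forall>\<^sub>F G in finite_subsets_at_top UNIV. dist (\<Sum>k\<in>G. (cmod (fourier_coeff f k))\<^sup>2) I < e"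
      unfolding eventually_finite_subsets_at_top using F by blast
  qed
  ultimately show ?thesis
    by simp
qed

section \<open>Sobolev bounds on coefficients and tails\<close>

text \<open>Each coordinate is bounded by the norm, so the ball lies in a finite box. This makes the
  sum over the ball genuine, since a sum over an infinite set is 0 by convention.\<close>

lemma finite_int_vec_norm_le: "finite {k :: int ^ 'n. norm (int_vec k) \<le> real K}"
proof (rule finite_subset)
  show "{k :: int ^ 'n. norm (int_vec k) \<le> real K} \<subseteq> vec_lambda ` (UNIV \<rightarrow>\<^sub>E {- int K..int K})"
  proof safe
    fix k :: "int ^ 'n"
    assume k: "norm (int_vec k) \<le> real K"
    have "k $ i \<in> {- int K..int K}" for i
    proof -
      have "\<bar>real_of_int (k $ i)\<bar> \<le> real K"
        using component_le_norm_cart[of "int_vec k" i] k by simp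
      then show ?thesis
        by simp linarith
    qed
    then show "k \<in> vec_lambda ` (UNIV \<rightarrow>\<^sub>E {- int K..int K})"
      by (intro image_eqI[of _ _ "vec_nth k"]) (auto simp: vec_nth_inverse)
  qed
qed (intro finite_imageI finite_PiE, auto)

lemma sobolev_norm_has_sum:
  assumes "f \<in> sobolev_space s"
  shows "((\<lambda>k. (1 + (norm (int_vec k))\<^sup>2) powr s * (cmod (fourier_coeff f k))\<^sup>2)
    has_sum (sobolev_norm s f)\<^sup>2) UNIV"
proof -
  have "(sobolev_norm s f)\<^sup>2 = (\<Sum>\<^sub>\<infinity>k. (1 + (norm (int_vec k))\<^sup>2) powr s * (cmod (fourier_coeff f k))\<^sup>2)"
    unfolding sobolev_norm_def by (intro real_sqrt_pow2 infsum_nonneg) simp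
  then show ?thesis
    using assms by (simp add: sobolev_space_def)
qed

text \<open>One term of a nonnegative series is at most its sum; the weight is written as the square
  of \<open>w powr (s / 2)\<close>, and roots are taken.\<close>

lemma fourier_coeff_le_sobolev_norm:
  assumes "f \<in> sobolev_space s"
  shows "cmod (fourier_coeff f k) \<le> sobolev_norm s f * (1 + (norm (int_vec k))\<^sup>2) powr (- s / 2)"
proof -
  define w where "w = 1 + (norm (int_vec k))\<^sup>2"
  have "0 < w"
    using zero_le_power2[of "norm (int_vec k)"] by (simp add: w_def add_pos_nonneg)
  have "w powr s * (cmod (fourier_coeff f k))\<^sup>2 \<le> (sobolev_norm s f)\<^sup>2"
    unfolding w_def
    using finite_sum_le_has_sum[OF sobolev_norm_has_sum[OF assms], of "{k}"] by simp
  moreover have "w powr s = (w powr (s / 2))\<^sup>2"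
    using \<open>0 < w\<close> by (simp add: powr_power)
  ultimately have "(w powr (s / 2) * cmod (fourier_coeff f k))\<^sup>2 \<le> (sobolev_norm s f)\<^sup>2"
    by (simp add: power_mult_distrib)
  then have "w powr (s / 2) * cmod (fourier_coeff f k) \<le> sobolev_norm s f"
    by (rule power2_le_imp_le) (simp add: sobolev_norm_def infsum_nonneg)
  then show ?thesis
    using \<open>0 < w\<close> by (simp add: w_def[symmetric] powr_minus field_simps)
qed

lemma fourier_tail_le_sobolev_norm:
  fixes f :: "real ^ 'n \<Rightarrow> complex"
  assumes f: "f \<in> sobolev_space s" and s: "0 \<le> s" and R: "0 < R"
  shows "(\<Sum>\<^sub>\<infinity>k\<in>{k. norm (int_vec k) > R}. (cmod (fourier_coeff f k))\<^sup>2)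
    \<le> (sobolev_norm s f)\<^sup>2 * R powr (- 2 * s)"
proof -
  let ?A = "{k :: int ^ 'n. norm (int_vec k) > R}"
  let ?w = "\<lambda>k. (1 + (norm (int_vec k))\<^sup>2) powr s * (cmod (fourier_coeff f k))\<^sup>2"
  have "f \<in> torus_L2"
    using f by (simp add: sobolev_space_def)
  then have summ: "(\<lambda>k. (cmod (fourier_coeff f k))\<^sup>2) summable_on ?A"
    using Parseval has_sum_imp_summable summable_on_subset_banach subset_UNIV by metis
  note hs = has_sum_cmult_left[OF sobolev_norm_has_sum[OF f], of "R powr (- 2 * s)"]
  show ?thesis
  \<comment> \<open>The tail is compared with the full Sobolev series scaled by
    \<open>R powr (- 2 * s)\<close>: termwise on \<open>?A\<close>, while the terms outside
    \<open>?A\<close> are nonnegative.\<close>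
  proof (rule has_sum_mono_neutral[OF has_sum_infsum[OF summ] hs])
    fix k
    assume "k \<in> ?A \<inter> UNIV"
    then have "R\<^sup>2 \<le> 1 + (norm (int_vec k))\<^sup>2"
      using R power_mono[of R "norm (int_vec k)" 2] by (simp add: add_increasing)
    then have "(R\<^sup>2) powr s \<le> (1 + (norm (int_vec k))\<^sup>2) powr s"
      using s by (intro powr_mono2) auto
    moreover have "(R\<^sup>2) powr s * R powr (- 2 * s) = 1"
      using R by (simp add: powr_powr powr_add[symmetric] flip: powr_numeral)
    ultimately have "1 \<le> (1 + (norm (int_vec k))\<^sup>2) powr s * R powr (- 2 * s)"
      by (metis mult_right_mono powr_ge_zero)
    from mult_right_mono[OF this, of "(cmod (fourier_coeff f k))\<^sup>2"]
    show "(cmod (fourier_coeff f k))\<^sup>2 \<le> ?w k * R powr (- 2 * s)"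
      by (simp add: mult_ac)
  qed auto
qed

section \<open>Decay of Fourier coefficients and the truncation error\<close>

text \<open>Quantifying \<open>C\<close> and \<open>C'\<close> before \<open>T\<close>,
  \<open>M\<close> and \<open>f\<close> expresses uniformity; only \<open>C'\<close> may depend on
  \<open>M\<close>. The supremum is taken in \<open>ereal\<close>, where an unbounded family has the
  value infinity, and summability is asserted because \<open>infsum\<close> defaults to 0.\<close>

theorem proposition3:
  fixes s :: real
  assumes "s > real CARD('n :: finite) / 2"
  shows "\<exists>(C :: real) (C' :: real \<Rightarrow> real).
    \<forall>(T :: real) (M :: real) (f :: real \<Rightarrow> real ^ 'n \<Rightarrow> complex).
      T > 0 \<longrightarrow> M \<ge> 0 \<longrightarrow> f \<in> continuous_sobolev T s \<longrightarrow>
      (SUP t\<in>{0..T}. ereal (sobolev_norm s (f t))) \<le> ereal M \<longrightarrow>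
        (\<forall>t\<in>{0..T}. \<forall>k. k \<noteq> 0 \<longrightarrow>
           cmod (fourier_coeff (f t) k) \<le> M * (1 + (norm (int_vec k))\<^sup>2) powr (- s / 2)) \<and>
        (\<forall>K::nat. K \<ge> 1 \<longrightarrow> (\<forall>t\<in>{0..T}.
           (\<lambda>k. (cmod (fourier_coeff (f t) k))\<^sup>2) summable_on {k. norm (int_vec k) > real K} \<and>
           (\<Sum>\<^sub>\<infinity>k\<in>{k. norm (int_vec k) > real K}. (cmod (fourier_coeff (f t) k))\<^sup>2)
             \<le> C * M\<^sup>2 * real K powr (real CARD('n) - 2 * s))) \<and>
        (\<forall>K::nat. K \<ge> 1 \<longrightarrow> (\<forall>t\<in>{0..T}. \<exists>r.
           0 \<le> r \<and> r \<le> C' M * real K powr (real CARD('n) - 2 * s) \<and>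
           (\<Sum>k\<in>{k. norm (int_vec k) \<le> real K}. (cmod (fourier_coeff (f t) k))\<^sup>2)
             = (torus_L2_norm (f t))\<^sup>2 - r))"
\<comment> \<open>Both witnesses come from the tail bound
  \<open>M\<^sup>2 * real K powr (- 2 * s)\<close>, which \<open>K \<ge> 1\<close> allows to be
  weakened to the exponent \<open>real CARD('n) - 2 * s\<close>.\<close>
proof (rule exI[of _ 1], rule exI[of _ "\<lambda>M. M\<^sup>2"], intro allI impI)
  fix T M :: real and f :: "real \<Rightarrow> real ^ 'n \<Rightarrow> complex"
  assume M: "0 \<le> M" and f: "f \<in> continuous_sobolev T s"
    and SUP: "(SUP t\<in>{0..T}. ereal (sobolev_norm s (f t))) \<le> ereal M"
  have s: "0 \<le> s"
    using assms by (smt (verit) divide_nonneg_nonneg of_nat_0_le_iff)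
  have Hs: "f t \<in> sobolev_space s" if "t \<in> {0..T}" for t
    using f that by (simp add: continuous_sobolev_def)
  have L2: "f t \<in> torus_L2" if "t \<in> {0..T}" for t
    using Hs[OF that] by (simp add: sobolev_space_def)
  have le_M: "sobolev_norm s (f t) \<le> M" if "t \<in> {0..T}" for t
    using SUP that by (simp add: SUP_le_iff)
  have summ: "(\<lambda>k. (cmod (fourier_coeff (f t) k))\<^sup>2) summable_on A" if "t \<in> {0..T}" for t A
    using Parseval[OF L2[OF that]] has_sum_imp_summable summable_on_subset_banach subset_UNIV by metis
  have tail: "(\<Sum>\<^sub>\<infinity>k\<in>{k. norm (int_vec k) > real K}. (cmod (fourier_coeff (f t) k))\<^sup>2)
      \<le> M\<^sup>2 * real K powr (real CARD('n) - 2 * s)" if K: "K \<ge> 1" and t: "t \<in> {0..T}" for K t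
  proof -
    have "(\<Sum>\<^sub>\<infinity>k\<in>{k. norm (int_vec k) > real K}. (cmod (fourier_coeff (f t) k))\<^sup>2)
        \<le> (sobolev_norm s (f t))\<^sup>2 * real K powr (- 2 * s)"
      using K by (intro fourier_tail_le_sobolev_norm Hs[OF t] s) simp
    also have "\<dots> \<le> M\<^sup>2 * real K powr (real CARD('n) - 2 * s)"
      using K by (intro mult_mono power_mono le_M[OF t] powr_mono)
        (auto simp: sobolev_norm_def infsum_nonneg)
    finally show ?thesis .
  qed
  \<comment> \<open>Parseval's series is cut into the ball, where \<open>infsum\<close> is a finite
    sum, and the tail, which becomes the witness for \<open>r\<close>.\<close>
  have split: "(\<Sum>k\<in>{k. norm (int_vec k) \<le> real K}. (cmod (fourier_coeff (f t) k))\<^sup>2)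
      = (torus_L2_norm (f t))\<^sup>2
        - (\<Sum>\<^sub>\<infinity>k\<in>{k. norm (int_vec k) > real K}. (cmod (fourier_coeff (f t) k))\<^sup>2)"
    if t: "t \<in> {0..T}" for K t
  proof -
    let ?g = "\<lambda>k. (cmod (fourier_coeff (f t) k))\<^sup>2"
    have "(torus_L2_norm (f t))\<^sup>2 = infsum ?g UNIV"
      using Parseval[OF L2[OF t]] by (simp add: infsumI)
    also have "UNIV = {k. norm (int_vec k) \<le> real K} \<union> {k :: int ^ 'n. norm (int_vec k) > real K}"
      by auto
    also have "infsum ?g \<dots> = infsum ?g {k. norm (int_vec k) \<le> real K}
        + infsum ?g {k. norm (int_vec k) > real K}"
      by (intro infsum_Un_disjoint summ[OF t]) auto
    finally show ?thesis
      by (simp add: finite_int_vec_norm_le)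
  qed
  show "(\<forall>t\<in>{0..T}. \<forall>k. k \<noteq> 0 \<longrightarrow>
           cmod (fourier_coeff (f t) k) \<le> M * (1 + (norm (int_vec k))\<^sup>2) powr (- s / 2)) \<and>
        (\<forall>K::nat. K \<ge> 1 \<longrightarrow> (\<forall>t\<in>{0..T}.
           (\<lambda>k. (cmod (fourier_coeff (f t) k))\<^sup>2) summable_on {k. norm (int_vec k) > real K} \<and>
           (\<Sum>\<^sub>\<infinity>k\<in>{k. norm (int_vec k) > real K}. (cmod (fourier_coeff (f t) k))\<^sup>2)
             \<le> 1 * M\<^sup>2 * real K powr (real CARD('n) - 2 * s))) \<and>
        (\<forall>K::nat. K \<ge> 1 \<longrightarrow> (\<forall>t\<in>{0..T}. \<exists>r.
           0 \<le> r \<and> r \<le> M\<^sup>2 * real K powr (real CARD('n) - 2 * s) \<and>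
           (\<Sum>k\<in>{k. norm (int_vec k) \<le> real K}. (cmod (fourier_coeff (f t) k))\<^sup>2)
             = (torus_L2_norm (f t))\<^sup>2 - r))"
  proof (intro conjI allI impI ballI)
    fix t k
    assume t: "t \<in> {0..T}"
    show "cmod (fourier_coeff (f t) k) \<le> M * (1 + (norm (int_vec k))\<^sup>2) powr (- s / 2)"
      using fourier_coeff_le_sobolev_norm[OF Hs[OF t], of k] le_M[OF t]
      by (meson mult_right_mono order_trans powr_ge_zero)
  next
    fix K :: nat and t
    assume K: "K \<ge> 1" and t: "t \<in> {0..T}"
    show "(\<lambda>k. (cmod (fourier_coeff (f t) k))\<^sup>2) summable_on {k. norm (int_vec k) > real K}"
      by (rule summ[OF t])
    show "(\<Sum>\<^sub>\<infinity>k\<in>{k. norm (int_vec k) > real K}. (cmod (fourier_coeff (f t) k))\<^sup>2)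
        \<le> 1 * M\<^sup>2 * real K powr (real CARD('n) - 2 * s)"
      using tail[OF K t] by simp
    show "\<exists>r. 0 \<le> r \<and> r \<le> M\<^sup>2 * real K powr (real CARD('n) - 2 * s) \<and>
           (\<Sum>k\<in>{k. norm (int_vec k) \<le> real K}. (cmod (fourier_coeff (f t) k))\<^sup>2)
             = (torus_L2_norm (f t))\<^sup>2 - r"
      using tail[OF K t] split[OF t] by (intro exI conjI) (auto intro!: infsum_nonneg)
  qed
qed

end
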